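(* For each integer $k\ge1$ let $\omega_{N_k}\subset\mathbb{S}^2$, $N_k=10k^2+2$, be the radial icosahedral configuration. Then the sequence of radial icosahedral configurations $\{\omega_{N_k}\}_{k\ge1}$ is quasi-uniform.
   Context: $\mathbb{S}^2=\{x\in\mathbb{R}^3:|x|=1\}$ with $|\cdot|$ the Euclidean norm. Radial icosahedral configurations: take a regular icosahedron centered at the origin with circumradius $1$ (edge length $a=\csc(2\pi/5)$). Given $k\in\mathbb{N}$, on each face $\mathcal{F}$, pick a vertex $v$ of $\mathcal{F}$ and let $e_1,e_2$ be the vectors of length $a/k$ in the directions of the two edges of $\mathcal{F}$ emanating from $v$; the points on $\mathcal{F}$ are the lattice points $v+pe_1+qe_2$ with integers $p,q\ge0$, $p+q\le k$ (this set does not depend on the choice of $v$). Let $\widetilde{\omega}_{N_k}$ be the union over all 20 faces; it has $N_k=10k^2+2$ points. With the radial projection $\Pi(x)=x/\|x\|$, set $\omega_{N_k}=\Pi(\widetilde{\omega}_{N_k})\subset\mathbb{S}^2$. For a finite configuration $\omega\subset\mathbb{S}^2$ with at least two points, $\delta(\omega)=\min_{x\ne y\in\omega}|x-y|$ is the separation, $\eta(\omega)=\max_{y\in\mathbb{S}^2}\min_{x\in\omega}|x-y|$ is the covering radius, and $\gamma(\omega)=\eta(\omega)/\delta(\omega)$ is the mesh ratio. A sequence of configurations is quasi-uniform if its sequence of mesh ratios is bounded. *)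

theory Defs
  imports "HOL-Analysis.Analysis"
begin

definition equilateral_triangle :: "real \<Rightarrow> (real ^ 3) set \<Rightarrow> bool" where
  "equilateral_triangle a T \<longleftrightarrow> a > 0 \<and>
     (\<exists>A B C. dist A B = a \<and> dist B C = a \<and> dist C A = a \<and> T = convex hull {A, B, C})"

definition vertices :: "(real ^ 3) set \<Rightarrow> (real ^ 3) set" where
  "vertices P = {v. v extreme_point_of P}"

definition regular_icosahedron :: "(real ^ 3) set \<Rightarrow> bool" where
  "regular_icosahedron P \<longleftrightarrow>
     polytope P \<and> aff_dim P = 3 \<and>
     card {F. F facet_of P} = 20 \<and>
     (\<exists>a. \<forall>F. F facet_of P \<longrightarrow> equilateral_triangle a F) \<and>
     (\<forall>v \<in> vertices P. card {F. F facet_of P \<and> v \<in> F} = 5)"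

text \<open>The center is the centroid of the vertices.\<close>

definition centered_at_origin :: "(real ^ 3) set \<Rightarrow> bool" where
  "centered_at_origin P \<longleftrightarrow> (\<Sum>v \<in> vertices P. v) = 0"

text \<open>The circumradius of a polytope whose circumcenter is the origin.\<close>

definition has_circumradius :: "(real ^ 3) set \<Rightarrow> real \<Rightarrow> bool" where
  "has_circumradius P r \<longleftrightarrow> (\<forall>v \<in> vertices P. norm v = r)"

text \<open>
  For a triangle \<open>F\<close> with vertices \<open>v, w1, w2\<close> and side length \<open>a\<close>, the vectors
  \<open>(w1 - v) /\<^sub>R k\<close> and \<open>(w2 - v) /\<^sub>R k\<close> have length \<open>a / k\<close> and point along the two
  edges at \<open>v\<close>. The resulting lattice does not depend on which vertex is called \<open>v\<close>,
  so the union over all labellings of the vertices is the lattice of any one of them.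
\<close>

definition face_lattice :: "nat \<Rightarrow> (real ^ 3) set \<Rightarrow> (real ^ 3) set" where
  "face_lattice k F =
     {v + real p *\<^sub>R e1 + real q *\<^sub>R e2 | v w1 w2 e1 e2 p q.
        vertices F = {v, w1, w2} \<and>
        e1 = (w1 - v) /\<^sub>R real k \<and> e2 = (w2 - v) /\<^sub>R real k \<and>
        p + q \<le> k}"

definition icosahedral_configuration :: "(real ^ 3) set \<Rightarrow> nat \<Rightarrow> (real ^ 3) set" where
  "icosahedral_configuration P k = (\<Union>F \<in> {F. F facet_of P}. face_lattice k F)"

definition radial_projection :: "real ^ 3 \<Rightarrow> real ^ 3" where
  "radial_projection x = x /\<^sub>R norm x"

definition radial_icosahedral_configuration :: "(real ^ 3) set \<Rightarrow> nat \<Rightarrow> (real ^ 3) set" where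
  "radial_icosahedral_configuration P k = radial_projection ` icosahedral_configuration P k"

definition spherical_configuration :: "(real ^ 3) set \<Rightarrow> bool" where
  "spherical_configuration \<omega> \<longleftrightarrow> finite \<omega> \<and> card \<omega> \<ge> 2 \<and> \<omega> \<subseteq> sphere 0 1"

definition separation :: "(real ^ 3) set \<Rightarrow> real" where
  "separation \<omega> = Min {dist x y | x y. x \<in> \<omega> \<and> y \<in> \<omega> \<and> x \<noteq> y}"

text \<open>
  For finite nonempty \<open>\<omega>\<close> the supremum is a maximum, since the sphere is compact.
\<close>

definition covering_radius :: "(real ^ 3) set \<Rightarrow> real" where
  "covering_radius \<omega> = (SUP y \<in> sphere 0 1. Min ((\<lambda>x. dist x y) ` \<omega>))"

definition mesh_ratio :: "(real ^ 3) set \<Rightarrow> real" where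
  "mesh_ratio \<omega> = covering_radius \<omega> / separation \<omega>"

text \<open>Sequences are indexed by the integers \<open>k \<ge> 1\<close>; the value at \<open>0\<close> is ignored.\<close>

definition quasi_uniform :: "(nat \<Rightarrow> (real ^ 3) set) \<Rightarrow> bool" where
  "quasi_uniform \<omega> \<longleftrightarrow>
     (\<forall>k\<ge>1. spherical_configuration (\<omega> k)) \<and> bounded ((\<lambda>k. mesh_ratio (\<omega> k)) ` {1..})"

end

theory Submission imports Defs begin

text \<open>
  Since \<open>0\<close> is interior to \<open>P\<close>, the cones over the facets cover space and every vector has unique
  nonnegative coordinates with respect to the vertices of the facet whose cone contains it.
  These coordinates are piecewise linear, hence globally Lipschitz. Normalized to have sum 1, they are
  invariant under radial projection, Lipschitz on the sphere, and take values in
  \<open>{0, 1/k, 2/k, \<dots>}\<close> at the points of the configuration; distinct points differ by at least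
  \<open>1/k\<close> in some coordinate, so the separation is at least of order \<open>1/k\<close>.
  Conversely, rounding the coordinates of the point where a ray leaves \<open>P\<close> gives a lattice point at
  distance at most \<open>4/k\<close>, and the radial projection is Lipschitz away from the origin, so the covering
  radius is at most of order \<open>1/k\<close>.
\<close>

section \<open>Facets of a simplicial polytope around the origin\<close>

locale simplicial_polytope =
  fixes P :: "(real ^ 3) set"
  assumes polytope: "polytope P"
    and zero_interior: "0 \<in> interior P"
    and simplicial: "F facet_of P \<Longrightarrow> \<not> affine_dependent (vertices F)"
begin

lemma facet_face: "F facet_of P \<Longrightarrow> F face_of P"
  by (simp add: facet_of_def)

lemma facet_eq_convex_hull:
  assumes "F facet_of P"
  shows "F = convex hull (vertices F)"
proof -
  have "polytope F"
    using assms facet_face face_of_polytope_polytope polytope by blast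
  then show ?thesis
    unfolding vertices_def
    by (intro Krein_Milman_Minkowski polytope_imp_compact polytope_imp_convex)
qed

lemma vertices_facet_subset:
  assumes "F facet_of P"
  shows "vertices F \<subseteq> vertices P" "vertices F \<subseteq> F"
  using extreme_point_of_face[OF facet_face[OF assms]] by (auto simp: vertices_def)

lemma finite_vertices: "finite (vertices P)"
proof -
  obtain S where S: "finite S" "P = convex hull S"
    using polytope by (auto simp: polytope_def)
  then have "vertices P \<subseteq> S"
    unfolding vertices_def using extreme_point_of_convex_hull by blast
  then show ?thesis
    using S(1) finite_subset by blast
qed

lemma finite_vertices_facet: "F facet_of P \<Longrightarrow> finite (vertices F)"
  using finite_vertices vertices_facet_subset finite_subset by blast

lemma finite_facets: "finite {F. F facet_of P}"
  using finite_polytope_facets polytope .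

lemma facet_functional:
  assumes "F facet_of P"
  obtains a where "\<And>x. x \<in> P \<Longrightarrow> a \<bullet> x \<le> 1" "F = {x \<in> P. a \<bullet> x = 1}"
proof -
  have F: "F face_of P" "F \<noteq> {}" "F \<noteq> P"
    using assms by (auto simp: facet_of_def)
  then have "F exposed_face_of P"
    using exposed_face_of_polyhedron polytope_imp_polyhedron polytope by blast
  then obtain a b where ab: "P \<subseteq> {x. a \<bullet> x \<le> b}" "F = P \<inter> {x. a \<bullet> x = b}"
    unfolding exposed_face_of_def by blast
  have "a \<noteq> 0"
  proof
    assume "a = 0"
    with ab F have "F = P" by (cases "b = 0") auto
    with F show False by simp
  qed
  \<comment> \<open>A small step from the interior point 0 in direction \<open>a\<close> stays in
    \<open>P\<close>, which forces \<open>b > 0\<close> and permits rescaling to right-hand side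
    1.\<close>
  obtain r where r: "r > 0" "cball 0 r \<subseteq> P"
    using zero_interior mem_interior_cball by blast
  have "(r / norm a) *\<^sub>R a \<in> P"
    using r \<open>a \<noteq> 0\<close> by (intro subsetD[OF r(2)]) auto
  then have "a \<bullet> ((r / norm a) *\<^sub>R a) \<le> b"
    using ab by auto
  moreover have "a \<bullet> ((r / norm a) *\<^sub>R a) > 0"
    using r \<open>a \<noteq> 0\<close> by simp
  ultimately have "b > 0" by linarith
  show thesis
  proof (rule that[of "a /\<^sub>R b"])
    show "(a /\<^sub>R b) \<bullet> x \<le> 1" if "x \<in> P" for x
      using ab(1) that \<open>b > 0\<close> by (auto simp: field_simps)
    show "F = {x \<in> P. (a /\<^sub>R b) \<bullet> x = 1}"
      using ab(2) \<open>b > 0\<close> by (auto simp: field_simps)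
  qed
qed

text \<open>The functional exposing \<open>F\<close> equals 1 at each of its vertices, so the
  coefficients of a linear relation sum to 0: the relation is an affine dependence.\<close>

lemma independent_vertices_facet:
  assumes "F facet_of P"
  shows "independent (vertices F)"
proof
  assume "dependent (vertices F)"
  then obtain u where u: "\<exists>v\<in>vertices F. u v \<noteq> 0" "(\<Sum>v\<in>vertices F. u v *\<^sub>R v) = 0"
    using dependent_finite[OF finite_vertices_facet[OF assms]] by auto
  obtain a where a: "F = {x \<in> P. a \<bullet> x = 1}"
    using facet_functional[OF assms] by metis
  have "a \<bullet> (\<Sum>v\<in>vertices F. u v *\<^sub>R v) = (\<Sum>v\<in>vertices F. u v)"
    unfolding inner_sum_right
    by (rule sum.cong) (use a vertices_facet_subset[OF assms] in auto)
  then have "affine_dependent (vertices F)"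
    unfolding affine_dependent_explicit_finite[OF finite_vertices_facet[OF assms]]
    using u by auto
  then show False
    using simplicial[OF assms] by simp
qed

section \<open>Linear coordinates on the cone over a facet\<close>

definition coord :: "(real ^ 3) set \<Rightarrow> real ^ 3 \<Rightarrow> real ^ 3 \<Rightarrow> real" where
  "coord F v = (SOME g. linear g \<and> (\<forall>w\<in>vertices F. g w = (if w = v then 1 else 0)))"

lemma coord:
  assumes "F facet_of P"
  shows "linear (coord F v)"
    and "w \<in> vertices F \<Longrightarrow> coord F v w = (if w = v then 1 else 0)"
proof -
  have "\<exists>g::real ^ 3 \<Rightarrow> real. linear g \<and> (\<forall>w\<in>vertices F. g w = (if w = v then 1 else 0))"
    using linear_independent_extend[OF independent_vertices_facet[OF assms]] .
  from someI_ex[OF this] show "linear (coord F v)"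
    "w \<in> vertices F \<Longrightarrow> coord F v w = (if w = v then 1 else 0)"
    by (auto simp: coord_def)
qed

text \<open>The cone with apex 0 over \<open>F\<close>, described by conditions on continuous
  functions so that its closedness is immediate.\<close>

definition facet_cone :: "(real ^ 3) set \<Rightarrow> (real ^ 3) set" where
  "facet_cone F = {z. (\<forall>v\<in>vertices F. 0 \<le> coord F v z) \<and>
     z = (\<Sum>v\<in>vertices F. coord F v z *\<^sub>R v)}"

lemma closed_facet_cone:
  assumes "F facet_of P"
  shows "closed (facet_cone F)"
proof -
  have c: "continuous_on UNIV (coord F v)" for v
    using coord(1)[OF assms] by (rule linear_continuous_on[OF linear_conv_bounded_linear[THEN iffD1]])
  have "facet_cone F = (\<Inter>v\<in>vertices F. {z. 0 \<le> coord F v z}) \<inter>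
      {z. z = (\<Sum>v\<in>vertices F. coord F v z *\<^sub>R v)}"
    by (auto simp: facet_cone_def)
  then show ?thesis
    by (auto intro!: closed_INT closed_Collect_le closed_Collect_eq continuous_intros c)
qed

lemma coord_combination:
  assumes "F facet_of P"
  shows "coord F v (\<Sum>w\<in>vertices F. c w *\<^sub>R w) = (if v \<in> vertices F then c v else 0)"
proof -
  have "coord F v (\<Sum>w\<in>vertices F. c w *\<^sub>R w) = (\<Sum>w\<in>vertices F. c w * coord F v w)"
    using coord(1)[OF assms] by (simp add: linear_sum linear_cmul)
  also have "\<dots> = (\<Sum>w\<in>vertices F. if w = v then c v else 0)"
    by (rule sum.cong) (auto simp: coord(2)[OF assms])
  finally show ?thesis
    using finite_vertices_facet[OF assms] by simp
qed

lemma facet_cone_combination: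
  assumes "F facet_of P" "\<And>v. v \<in> vertices F \<Longrightarrow> 0 \<le> c v"
  shows "(\<Sum>w\<in>vertices F. c w *\<^sub>R w) \<in> facet_cone F"
  using assms by (auto simp: facet_cone_def coord_combination)

text \<open>Lets coordinates belonging to different facets be compared through sums over the common
  index set \<open>vertices P\<close>.\<close>

lemma coord_outside:
  assumes "F facet_of P" "z \<in> facet_cone F" "v \<notin> vertices F"
  shows "coord F v z = 0"
  using assms coord_combination[OF assms(1), of v "\<lambda>w. coord F w z"]
  by (simp add: facet_cone_def)

lemma coord_nonneg:
  assumes "F facet_of P" "z \<in> facet_cone F"
  shows "0 \<le> coord F v z"
  using assms coord_outside[OF assms] by (cases "v \<in> vertices F") (auto simp: facet_cone_def)

lemma sum_coord_facet:
  fixes f :: "real ^ 3 \<Rightarrow> real ^ 3"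
  assumes "F facet_of P" "z \<in> facet_cone F"
  shows "(\<Sum>v\<in>vertices P. coord F v z *\<^sub>R f v) = (\<Sum>v\<in>vertices F. coord F v z *\<^sub>R f v)"
  by (rule sum.mono_neutral_right)
     (use assms finite_vertices vertices_facet_subset coord_outside in auto)

lemma combination_facet_cone:
  assumes "F facet_of P" "z \<in> facet_cone F"
  shows "(\<Sum>v\<in>vertices P. coord F v z *\<^sub>R v) = z"
  using sum_coord_facet[OF assms, of "\<lambda>v. v"] assms by (simp add: facet_cone_def)

text \<open>The functional exposing \<open>F\<close> reads off the coordinate sum of \<open>z\<close> in \<open>F\<close>, and is a lower
  bound for the coordinate sum of \<open>z\<close> in any other facet.\<close>

lemma coord_unique:
  assumes F: "F facet_of P" "z \<in> facet_cone F" and G: "G facet_of P" "z \<in> facet_cone G"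
  shows "coord F v z = coord G v z"
proof -
  have sum_le: "(\<Sum>v\<in>vertices P. coord F v z) \<le> (\<Sum>v\<in>vertices P. coord G v z) \<and>
    ((\<Sum>v\<in>vertices P. coord F v z) = (\<Sum>v\<in>vertices P. coord G v z) \<longrightarrow>
      (\<forall>v\<in>vertices P. v \<notin> vertices F \<longrightarrow> coord G v z = 0))"
    if F: "F facet_of P" "z \<in> facet_cone F" and G: "G facet_of P" "z \<in> facet_cone G" for F G
  proof -
    obtain a where a: "\<And>x. x \<in> P \<Longrightarrow> a \<bullet> x \<le> 1" "F = {x \<in> P. a \<bullet> x = 1}"
      using facet_functional[OF F(1)] by metis
    have VP: "vertices P \<subseteq> P"
      by (auto simp: vertices_def extreme_point_of_def)
    have "a \<bullet> z = a \<bullet> (\<Sum>v\<in>vertices P. coord F v z *\<^sub>R v)"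
      using combination_facet_cone[OF F] by simp
    also have "\<dots> = (\<Sum>v\<in>vertices P. coord F v z)"
      unfolding inner_sum_right
    proof (rule sum.cong)
      fix v assume "v \<in> vertices P"
      show "a \<bullet> coord F v z *\<^sub>R v = coord F v z"
        using coord_outside[OF F, of v] a(2) vertices_facet_subset(2)[OF F(1)]
        by (cases "v \<in> vertices F") auto
    qed simp
    finally have "a \<bullet> z = (\<Sum>v\<in>vertices P. coord F v z)" .
    moreover have "a \<bullet> z = a \<bullet> (\<Sum>v\<in>vertices P. coord G v z *\<^sub>R v)"
      using combination_facet_cone[OF G] by simp
    \<comment> \<open>Both expansions evaluate the same number \<open>a \<bullet> z\<close>. The
      vertices of \<open>F\<close> count with weight 1, all others with weight at most 1, so the
      difference of the sums consists of nonnegative defects.\<close>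
    ultimately have diff: "(\<Sum>v\<in>vertices P. coord G v z) - (\<Sum>v\<in>vertices P. coord F v z) =
        (\<Sum>v\<in>vertices P. coord G v z * (1 - a \<bullet> v))"
      by (simp add: inner_sum_right algebra_simps sum_subtractf)
    have nonneg: "0 \<le> coord G v z * (1 - a \<bullet> v)" if "v \<in> vertices P" for v
      using coord_nonneg[OF G] a(1) that VP by (auto intro!: mult_nonneg_nonneg)
    \<comment> \<open>Equal sums make every defect vanish; off \<open>F\<close> the factor
      \<open>1 - a \<bullet> v\<close> is nonzero, so the coordinate must be 0.\<close>
    have "coord G v z = 0"
      if eq: "(\<Sum>v\<in>vertices P. coord F v z) = (\<Sum>v\<in>vertices P. coord G v z)"
        and v: "v \<in> vertices P" "v \<notin> vertices F" for v
    proof -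
      have "coord G v z * (1 - a \<bullet> v) = 0"
        using diff eq nonneg v(1) finite_vertices by (simp add: sum_nonneg_eq_0_iff)
      moreover have "v \<notin> F"
        using v extreme_point_of_face[OF facet_face[OF F(1)]] by (auto simp: vertices_def)
      ultimately show ?thesis
        using a(2) v(1) VP by auto
    qed
    moreover have "0 \<le> (\<Sum>v\<in>vertices P. coord G v z * (1 - a \<bullet> v))"
      using nonneg by (rule sum_nonneg)
    ultimately show ?thesis
      unfolding diff[symmetric] by (metis diff_ge_0_iff_ge)
  qed
  \<comment> \<open>Exchanging \<open>F\<close> and \<open>G\<close> gives equality. Then the
    expansion in \<open>G\<close> only involves vertices of \<open>F\<close>, and applying
    \<open>coord F v\<close> to it reads off the claim.\<close>
  have "(\<Sum>v\<in>vertices P. coord F v z) = (\<Sum>v\<in>vertices P. coord G v z)"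
    using sum_le[OF F G] sum_le[OF G F] by linarith
  then have "\<forall>v\<in>vertices P. v \<notin> vertices F \<longrightarrow> coord G v z = 0"
    using sum_le[OF F G] by blast
  then have "(\<Sum>v\<in>vertices P. coord G v z *\<^sub>R v) = (\<Sum>v\<in>vertices F. coord G v z *\<^sub>R v)"
    using finite_vertices vertices_facet_subset(1)[OF F(1)]
    by (intro sum.mono_neutral_right) auto
  then have "z = (\<Sum>v\<in>vertices F. coord G v z *\<^sub>R v)"
    using combination_facet_cone[OF G] by simp
  then have "coord F v z = coord F v (\<Sum>v\<in>vertices F. coord G v z *\<^sub>R v)"
    by (rule arg_cong)
  then have *: "coord F v z = (if v \<in> vertices F then coord G v z else 0)"
    unfolding coord_combination[OF F(1)] .
  show ?thesis
  proof (cases "v \<in> vertices P")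
    case True
    then show ?thesis
      using * \<open>\<forall>v\<in>vertices P. v \<notin> vertices F \<longrightarrow> coord G v z = 0\<close> by auto
  next
    case False
    then show ?thesis
      using * coord_outside[OF G] vertices_facet_subset F G by auto
  qed
qed

text \<open>Nonempty interior makes the frontier the relative frontier, which for a polyhedron is
  the union of its facets. That the exit point is not interior later bounds \<open>d\<close> from
  below.\<close>

lemma ray_meets_facet:
  assumes "z \<noteq> 0"
  obtains F d where "F facet_of P" "d > 0" "d *\<^sub>R z \<in> F" "d *\<^sub>R z \<notin> interior P"
proof -
  obtain d where d: "d > 0" "0 + d *\<^sub>R z \<in> frontier P"
    using ray_to_frontier[OF polytope_imp_bounded[OF polytope] zero_interior assms] by metis
  have "rel_frontier P = frontier P"
    unfolding rel_frontier_def frontier_def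
    using rel_interior_nonempty_interior zero_interior by fastforce
  then have "d *\<^sub>R z \<in> \<Union> {F. F facet_of P}"
    using d rel_frontier_of_polyhedron[OF polytope_imp_polyhedron[OF polytope]] by simp
  then show thesis
    using that d by (auto simp: frontier_def)
qed

lemma facet_point_coords:
  assumes "F facet_of P" "x \<in> F"
  obtains c where "\<And>v. v \<in> vertices F \<Longrightarrow> 0 \<le> c v" "sum c (vertices F) = 1"
    "x = (\<Sum>v\<in>vertices F. c v *\<^sub>R v)"
proof -
  have "x \<in> convex hull (vertices F)"
    using assms facet_eq_convex_hull by metis
  then show thesis
    using that convex_hull_finite[OF finite_vertices_facet[OF assms(1)]] by auto
qed

section \<open>The cones cover space; globally defined heights\<close>

lemma facet_cones_cover: "\<exists>F. F facet_of P \<and> z \<in> facet_cone F"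
proof (cases "z = 0")
  case True
  \<comment> \<open>Zero lies in the cone over every facet; an arbitrary ray shows that there is a
    facet.\<close>
  obtain F where F: "F facet_of P"
    using ray_meets_facet[of "axis 1 1"] by (metis axis_eq_0_iff zero_neq_one)
  have "z \<in> facet_cone F"
    using facet_cone_combination[OF F, of "\<lambda>_. 0"] True by simp
  with F show ?thesis by blast
next
  case False
  then obtain F d where F: "F facet_of P" and d: "d > 0" "d *\<^sub>R z \<in> F"
    using ray_meets_facet by metis
  obtain c where c: "\<And>v. v \<in> vertices F \<Longrightarrow> 0 \<le> c v"
    "d *\<^sub>R z = (\<Sum>v\<in>vertices F. c v *\<^sub>R v)"
    using facet_point_coords[OF F d(2)] by metis
  have "z = (1 / d) *\<^sub>R (d *\<^sub>R z)"
    using d by simp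
  also have "\<dots> = (\<Sum>v\<in>vertices F. (c v / d) *\<^sub>R v)"
    unfolding c(2) by (simp add: scaleR_right.sum)
  finally have "z \<in> facet_cone F"
    using facet_cone_combination[OF F, of "\<lambda>v. c v / d"] c(1) d(1) by simp
  with F show ?thesis by blast
qed

text \<open>The choice of the cone is harmless, because \<open>coord_unique\<close> makes the
  coordinates agree where cones overlap.\<close>

definition height :: "real ^ 3 \<Rightarrow> real ^ 3 \<Rightarrow> real" where
  "height v z = coord (SOME F. F facet_of P \<and> z \<in> facet_cone F) v z"

lemma height_eq_coord:
  assumes "F facet_of P" "z \<in> facet_cone F"
  shows "height v z = coord F v z"
proof -
  have "(SOME F. F facet_of P \<and> z \<in> facet_cone F) facet_of P \<and>
      z \<in> facet_cone (SOME F. F facet_of P \<and> z \<in> facet_cone F)"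
    using someI_ex[OF facet_cones_cover] .
  then show ?thesis
    unfolding height_def using coord_unique assms by blast
qed

lemma height_nonneg: "0 \<le> height v z"
  using facet_cones_cover[of z] height_eq_coord coord_nonneg by metis

lemma sum_height: "(\<Sum>v\<in>vertices P. height v z *\<^sub>R v) = z"
proof -
  obtain F where F: "F facet_of P" "z \<in> facet_cone F"
    using facet_cones_cover by blast
  show ?thesis
    using combination_facet_cone[OF F] by (simp add: height_eq_coord[OF F])
qed

lemma height_combination:
  assumes "F facet_of P" "\<And>v. v \<in> vertices F \<Longrightarrow> 0 \<le> c v"
  shows "height v (\<Sum>w\<in>vertices F. c w *\<^sub>R w) = (if v \<in> vertices F then c v else 0)"
  using height_eq_coord[OF assms(1) facet_cone_combination[OF assms]] coord_combination[OF assms(1)]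
  by simp

text \<open>Restrict the height to the segment from \<open>x\<close> to \<open>y\<close>. Finitely
  many closed cones cut the parameter interval into closed pieces with a common Lipschitz constant,
  which therefore holds on the whole interval.\<close>

lemma height_lipschitz:
  "\<exists>L>0. \<forall>v\<in>vertices P. \<forall>x y. \<bar>height v x - height v y\<bar> \<le> L * norm (x - y)"
proof -
  define I where "I = {F. F facet_of P} \<times> vertices P"
  \<comment> \<open>The sum dominates each single operator norm, and the summand 1 makes
    \<open>L\<close> positive.\<close>
  define L where "L = 1 + (\<Sum>(F, v)\<in>I. onorm (coord F v))"
  have bl: "bounded_linear (coord F v)" if "F facet_of P" for F v
    using coord(1)[OF that] linear_conv_bounded_linear by blast
  have nonneg: "0 \<le> onorm (coord F v)" if "F facet_of P" for F v
    using bl[OF that] by (rule onorm_pos_le)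
  have "finite I"
    using finite_facets finite_vertices by (simp add: I_def)
  have "L > 0"
    unfolding L_def by (rule add_pos_nonneg) (auto simp: I_def intro!: sum_nonneg nonneg)
  have coord_L: "\<bar>coord F v x - coord F v y\<bar> \<le> L * norm (x - y)"
    if F: "F facet_of P" and v: "v \<in> vertices P" for F v x y
  proof -
    have "(F, v) \<in> I"
      using F v by (simp add: I_def)
    then have "onorm (coord F v) \<le> (\<Sum>(F, v)\<in>I. onorm (coord F v))"
      using member_le_sum[of "(F, v)" I "\<lambda>(F, v). onorm (coord F v)"] \<open>finite I\<close> nonneg
      by (auto simp: I_def)
    then have "onorm (coord F v) \<le> L"
      by (simp add: L_def)
    moreover have "\<bar>coord F v (x - y)\<bar> \<le> onorm (coord F v) * norm (x - y)"
      using onorm[OF bl[OF F], of v "x - y"] by simp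
    ultimately have "\<bar>coord F v (x - y)\<bar> \<le> L * norm (x - y)"
      by (meson mult_right_mono norm_ge_zero order_trans)
    then show ?thesis
      using linear_diff[OF coord(1)[OF F]] by simp
  qed
  have "\<bar>height v x - height v y\<bar> \<le> L * norm (x - y)" if v: "v \<in> vertices P" for v x y
  proof -
    define g where "g t = x + t *\<^sub>R (y - x)" for t :: real
    have norm_g: "norm (g s - g t) = norm (x - y) * \<bar>s - t\<bar>" for s t
    proof -
      have "g s - g t = (s - t) *\<^sub>R (y - x)"
        by (simp add: g_def algebra_simps)
      then show ?thesis by (simp add: norm_minus_commute)
    qed
    have "(L * norm (x - y))-lipschitz_on {0..1} (\<lambda>t. height v (g t))"
    proof (rule lipschitz_on_closed_Union[where I = "{F. F facet_of P}" and U = "\<lambda>F. g -` facet_cone F"])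
      fix F assume "F \<in> {F. F facet_of P}"
      then have F: "F facet_of P" by simp
      show "(L * norm (x - y))-lipschitz_on (g -` facet_cone F) (\<lambda>t. height v (g t))"
      proof (rule lipschitz_onI)
        fix s t assume "s \<in> g -` facet_cone F" "t \<in> g -` facet_cone F"
        then have "dist (height v (g s)) (height v (g t)) \<le> L * norm (g s - g t)"
          using coord_L[OF F v] by (simp add: height_eq_coord[OF F] dist_real_def)
        then show "dist (height v (g s)) (height v (g t)) \<le> L * norm (x - y) * dist s t"
          by (simp add: norm_g dist_real_def mult.assoc)
      qed (use \<open>L > 0\<close> in simp)
      show "closed (g -` facet_cone F)"
        by (rule closed_vimage[OF closed_facet_cone[OF F]]) (auto simp: g_def intro!: continuous_intros)
    next
      show "{0..1} \<subseteq> (\<Union>F\<in>{F. F facet_of P}. g -` facet_cone F)"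
        using facet_cones_cover by auto
    qed (use finite_facets \<open>L > 0\<close> in auto)
    from lipschitz_onD[OF this, of 0 1] show ?thesis
      by (simp add: g_def dist_real_def abs_minus_commute)
  qed
  with \<open>L > 0\<close> show ?thesis
    by blast
qed

text \<open>This is the Minkowski gauge of \<open>P\<close>: on the cone over a facet it agrees with
  the functional that is 1 on that facet.\<close>

definition total_height :: "real ^ 3 \<Rightarrow> real" where
  "total_height z = (\<Sum>v\<in>vertices P. height v z)"

lemma height_le_total_height: "v \<in> vertices P \<Longrightarrow> height v z \<le> total_height z"
  unfolding total_height_def using finite_vertices height_nonneg by (intro member_le_sum) auto

lemma total_height_combination:
  assumes "F facet_of P" "\<And>v. v \<in> vertices F \<Longrightarrow> 0 \<le> c v"
  shows "total_height (\<Sum>w\<in>vertices F. c w *\<^sub>R w) = sum c (vertices F)"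
proof -
  have "vertices P \<inter> vertices F = vertices F"
    using vertices_facet_subset(1)[OF assms(1)] by blast
  then show ?thesis
    unfolding total_height_def
    by (simp add: height_combination[OF assms] finite_vertices sum.inter_restrict[symmetric])
qed

end

section \<open>Radial projection and a criterion for quasi-uniformity\<close>

lemma norm_radial_projection_diff_le:
  assumes "z \<noteq> 0"
  shows "norm (radial_projection x - radial_projection z) \<le> 2 * norm (x - z) / norm z"
proof -
  have z: "norm z > 0"
    using assms by simp
  \<comment> \<open>The intermediate point is \<open>x /\<^sub>R norm z\<close>. Each of the two
    differences has norm at most \<open>norm (x - z) / norm z\<close>, whence the factor 2.\<close>
  have eq: "radial_projection x - radial_projection z =
      (1 - norm x / norm z) *\<^sub>R radial_projection x + (x - z) /\<^sub>R norm z"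
    using z by (cases "x = 0") (simp_all add: radial_projection_def algebra_simps divide_inverse)
  \<comment> \<open>Only an inequality, since the projection of 0 is 0.\<close>
  have "norm (radial_projection x) \<le> 1"
    by (cases "x = 0") (simp_all add: radial_projection_def)
  then have "norm ((1 - norm x / norm z) *\<^sub>R radial_projection x) \<le> \<bar>1 - norm x / norm z\<bar>"
    by (simp add: mult_left_le)
  also have "\<bar>1 - norm x / norm z\<bar> = \<bar>(norm z - norm x) / norm z\<bar>"
    using z by (simp add: diff_divide_distrib)
  also have "\<bar>(norm z - norm x) / norm z\<bar> \<le> norm (x - z) / norm z"
    using norm_triangle_ineq3[of x z] z by (simp add: divide_right_mono abs_minus_commute)
  finally have "norm ((1 - norm x / norm z) *\<^sub>R radial_projection x) \<le> norm (x - z) / norm z" .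
  moreover have "norm ((x - z) /\<^sub>R norm z) = norm (x - z) / norm z"
    by (simp add: divide_inverse_commute)
  ultimately show ?thesis
    unfolding eq by (intro order_trans[OF norm_triangle_ineq]) simp
qed

text \<open>Separation and covering radius are compared with the same scale
  \<open>1 / real k\<close>, which cancels in the mesh ratio and leaves the bound
  \<open>C / s\<close>.\<close>

lemma quasi_uniformI:
  assumes spherical: "\<And>k. k \<ge> 1 \<Longrightarrow> spherical_configuration (\<omega> k)"
    and s: "s > 0" "\<And>k x y. \<lbrakk>k \<ge> 1; x \<in> \<omega> k; y \<in> \<omega> k; x \<noteq> y\<rbrakk> \<Longrightarrow> s / real k \<le> dist x y"
    and C: "\<And>k y. \<lbrakk>k \<ge> 1; norm y = 1\<rbrakk> \<Longrightarrow> \<exists>x\<in>\<omega> k. dist x y \<le> C / real k"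
  shows "quasi_uniform \<omega>"
proof -
  have "norm (mesh_ratio (\<omega> k)) \<le> C / s" if k: "k \<ge> 1" for k
  proof -
    define W where "W = \<omega> k"
    have W: "finite W" "card W \<ge> 2" "W \<noteq> {}"
      using spherical[OF k] by (auto simp: spherical_configuration_def W_def)
    define D where "D = {dist x y | x y. x \<in> W \<and> y \<in> W \<and> x \<noteq> y}"
    have "finite D"
      by (rule finite_subset[of _ "(\<lambda>(x, y). dist x y) ` (W \<times> W)"]) (use W in \<open>auto simp: D_def\<close>)
    \<comment> \<open>Two distinct points make the minimum defining the separation one over a
      nonempty set.\<close>
    obtain x y where "x \<in> W" "y \<in> W" "x \<noteq> y"
      using W(2) card_le_Suc0_iff_eq[OF W(1)] by (metis Suc_n_not_le_n numeral_2_eq_2 order_trans)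
    then have "D \<noteq> {}"
      by (auto simp: D_def)
    have "s / real k \<le> Min D"
      using \<open>finite D\<close> \<open>D \<noteq> {}\<close> s(2)[OF k] by (auto simp: D_def W_def)
    then have sep: "s / real k \<le> separation W"
      by (simp add: separation_def D_def)
    have Min_nonneg: "0 \<le> Min ((\<lambda>x. dist x y) ` W)" for y
      using W by simp
    have Min_le: "Min ((\<lambda>x. dist x y) ` W) \<le> C / real k" if "y \<in> sphere 0 1" for y
      using C[OF k, of y] that W by (subst Min_le_iff) (auto simp: W_def)
    \<comment> \<open>Any point of the sphere serves: it makes the supremum range over a nonempty
      set and, being a lower witness, shows that the covering radius is nonnegative.\<close>
    have e: "axis 1 1 \<in> sphere (0 :: real ^ 3) 1"
      by simp
    have le: "covering_radius W \<le> C / real k"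
      unfolding covering_radius_def using Min_le e by (intro cSUP_least) blast+
    have "bdd_above ((\<lambda>y. Min ((\<lambda>x. dist x y) ` W)) ` sphere 0 1)"
      using Min_le by (rule bdd_aboveI2)
    then have nonneg: "0 \<le> covering_radius W"
      unfolding covering_radius_def by (rule cSUP_upper2[OF _ e Min_nonneg])
    have pos: "0 < s / real k"
      using s(1) k by simp
    have "covering_radius W / separation W \<le> (C / real k) / (s / real k)"
      by (rule frac_le[OF order_trans[OF nonneg le] le pos sep])
    moreover have "0 \<le> covering_radius W / separation W"
      by (intro divide_nonneg_nonneg nonneg) (use pos sep in linarith)
    ultimately have "\<bar>covering_radius W / separation W\<bar> \<le> (C / real k) / (s / real k)"
      by simp
    then show ?thesis
      using k by (simp add: mesh_ratio_def W_def)
  qed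
  then show ?thesis
    unfolding quasi_uniform_def using spherical by (auto intro!: boundedI)
qed

lemma face_latticeI:
  assumes "vertices F = {v, w1, w2}" "p + q \<le> k"
  shows "v + real p *\<^sub>R ((w1 - v) /\<^sub>R real k) + real q *\<^sub>R ((w2 - v) /\<^sub>R real k) \<in> face_lattice k F"
  unfolding face_lattice_def using assms by blast

section \<open>Vertices on the unit sphere: normalized heights\<close>

locale inscribed_simplicial_polytope = simplicial_polytope +
  assumes card_vertices_facet: "F facet_of P \<Longrightarrow> card (vertices F) = 3"
    and norm_vertex: "v \<in> vertices P \<Longrightarrow> norm v = 1"
begin

text \<open>The triangle inequality for \<open>z\<close> as a combination of unit vectors. On the
  unit sphere the total height is thus at least 1 and can safely be divided by.\<close>

lemma norm_le_total_height: "norm z \<le> total_height z"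
proof -
  have "norm (\<Sum>v\<in>vertices P. height v z *\<^sub>R v) \<le> (\<Sum>v\<in>vertices P. height v z)"
    by (rule sum_norm_le) (simp add: norm_vertex height_nonneg)
  then show ?thesis
    by (simp add: sum_height total_height_def)
qed

lemma height_scale:
  assumes "0 \<le> t"
  shows "height v (t *\<^sub>R z) = t * height v z"
proof -
  obtain F where F: "F facet_of P" "z \<in> facet_cone F"
    using facet_cones_cover by blast
  have "coord F v (t *\<^sub>R z) = t * coord F v z" for v
    using linear_cmul[OF coord(1)[OF F(1)]] by simp
  moreover from this have "t *\<^sub>R z \<in> facet_cone F"
    using F(2) assms unfolding facet_cone_def
    by (auto simp: scaleR_sum_right[symmetric] simp flip: scaleR_scaleR)
  ultimately show ?thesis
    using F height_eq_coord by simp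
qed

text \<open>For nonzero \<open>z\<close>, these are the barycentric coordinates of the point where
  the ray through \<open>z\<close> leaves \<open>P\<close>.\<close>

definition bary :: "real ^ 3 \<Rightarrow> real ^ 3 \<Rightarrow> real" where
  "bary v z = height v z / total_height z"

lemma bary_scale: "0 < t \<Longrightarrow> bary v (t *\<^sub>R z) = bary v z"
  by (simp add: bary_def total_height_def height_scale flip: sum_distrib_left)

lemma bary_lipschitz_on_sphere:
  "\<exists>K>0. \<forall>v\<in>vertices P. \<forall>x\<in>sphere 0 1. \<forall>y\<in>sphere 0 1. \<bar>bary v x - bary v y\<bar> \<le> K * norm (x - y)"
proof -
  obtain L where L: "L > 0"
    "\<And>v x y. v \<in> vertices P \<Longrightarrow> \<bar>height v x - height v y\<bar> \<le> L * norm (x - y)"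
    using height_lipschitz by blast
  define n where "n = real (card (vertices P))"
  have total: "\<bar>total_height x - total_height y\<bar> \<le> n * L * norm (x - y)" for x y
  proof -
    have "\<bar>total_height x - total_height y\<bar> \<le> (\<Sum>v\<in>vertices P. \<bar>height v x - height v y\<bar>)"
      unfolding total_height_def sum_subtractf[symmetric] by (rule sum_abs)
    also have "\<dots> \<le> n * (L * norm (x - y))"
      unfolding n_def using L(2) by (rule sum_bounded_above)
    finally show ?thesis by (simp add: mult.assoc)
  qed
  have "\<bar>bary v x - bary v y\<bar> \<le> (L + n * L) * norm (x - y)"
    if v: "v \<in> vertices P" and xy: "norm x = 1" "norm y = 1" for v x y
  proof -
    have ge: "total_height x \<ge> 1" "total_height y \<ge> 1"
      using norm_le_total_height[of x] norm_le_total_height[of y] xy by auto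
    have bary: "0 \<le> bary v y" "bary v y \<le> 1"
      using ge height_le_total_height[OF v, of y] height_nonneg[of v y] by (auto simp: bary_def)
    \<comment> \<open>A discrete quotient rule. As \<open>bary v y\<close> is at most 1 and
      \<open>total_height x\<close> at least 1, the Lipschitz constants of numerator and denominator
      simply add.\<close>
    have "total_height x * (bary v x - bary v y) =
        (height v x - height v y) - bary v y * (total_height x - total_height y)"
      using ge by (simp add: bary_def field_simps)
    then have "total_height x * \<bar>bary v x - bary v y\<bar> =
        \<bar>(height v x - height v y) - bary v y * (total_height x - total_height y)\<bar>"
      using ge by (metis abs_mult abs_of_nonneg order_trans zero_le_one)
    also have "\<dots> \<le> \<bar>height v x - height v y\<bar> + bary v y * \<bar>total_height x - total_height y\<bar>"
      using abs_triangle_ineq4 bary by (metis abs_mult abs_of_nonneg)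
    also have "\<dots> \<le> L * norm (x - y) + 1 * (n * L * norm (x - y))"
      using bary L(2)[OF v] total by (intro add_mono mult_mono) auto
    finally have "total_height x * \<bar>bary v x - bary v y\<bar> \<le> (L + n * L) * norm (x - y)"
      by (simp add: algebra_simps)
    moreover have "\<bar>bary v x - bary v y\<bar> \<le> total_height x * \<bar>bary v x - bary v y\<bar>"
      using mult_right_mono[OF ge(1) abs_ge_zero] by simp
    ultimately show ?thesis
      by (rule order_trans[rotated])
  qed
  moreover have "L + n * L > 0"
    using L(1) by (simp add: n_def add_pos_nonneg)
  ultimately show ?thesis
    by (intro exI[of _ "L + n * L"]) auto
qed

section \<open>Heights of lattice points and the separation bound\<close>

lemma face_lattice_coords:
  assumes F: "F facet_of P" and x: "x \<in> face_lattice k F" and k: "k \<ge> 1"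
  obtains c :: "real ^ 3 \<Rightarrow> nat" where "sum c (vertices F) = k"
    "x = (\<Sum>v\<in>vertices F. (real (c v) / real k) *\<^sub>R v)"
proof -
  obtain v w1 w2 p q where V: "vertices F = {v, w1, w2}" and pq: "p + q \<le> k"
    and x: "x = v + real p *\<^sub>R ((w1 - v) /\<^sub>R real k) + real q *\<^sub>R ((w2 - v) /\<^sub>R real k)"
    using x unfolding face_lattice_def by blast
  have neq: "v \<noteq> w1" "v \<noteq> w2" "w1 \<noteq> w2"
    using card_vertices_facet[OF F] unfolding V by (auto simp: card_insert_if split: if_splits)
  \<comment> \<open>The base vertex receives the remaining weight; the subtraction is not truncated,
    since \<open>p + q \<le> k\<close>.\<close>
  define c where "c u = (if u = v then k - p - q else if u = w1 then p else q)" for u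
  have "(\<Sum>u\<in>vertices F. (real (c u) / real k) *\<^sub>R u) =
      (real (k - p - q) / real k) *\<^sub>R v + (real p / real k) *\<^sub>R w1 + (real q / real k) *\<^sub>R w2"
    unfolding V using neq by (simp add: c_def)
  also have "real (k - p - q) / real k = 1 - real p / real k - real q / real k"
    using pq k by (simp add: field_simps of_nat_diff)
  also have "(1 - real p / real k - real q / real k) *\<^sub>R v +
      (real p / real k) *\<^sub>R w1 + (real q / real k) *\<^sub>R w2 = x"
    by (simp add: x algebra_simps divide_inverse)
  finally have "x = (\<Sum>u\<in>vertices F. (real (c u) / real k) *\<^sub>R u)" ..
  moreover have "sum c (vertices F) = k"
    unfolding V using neq pq by (simp add: c_def)
  ultimately show thesis
    by (rule that[rotated])
qed

text \<open>Lattice points are convex combinations of the vertices of one facet with weights in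
  multiples of \<open>1 / real k\<close>; at all other vertices the height is 0.\<close>

lemma lattice_heights:
  assumes x: "x \<in> icosahedral_configuration P k" and k: "k \<ge> 1"
  shows "total_height x = 1" "\<exists>m::nat. height v x = real m / real k"
proof -
  obtain F where F: "F facet_of P" and "x \<in> face_lattice k F"
    using x by (auto simp: icosahedral_configuration_def)
  then obtain c where c: "sum c (vertices F) = k"
    "x = (\<Sum>v\<in>vertices F. (real (c v) / real k) *\<^sub>R v)"
    using face_lattice_coords[OF F _ k] by blast
  have "total_height x = (\<Sum>v\<in>vertices F. real (c v) / real k)"
    unfolding c(2) by (rule total_height_combination[OF F]) simp
  then show "total_height x = 1"
    using c(1) k by (simp flip: sum_divide_distrib of_nat_sum)
  have "height v x = (if v \<in> vertices F then real (c v) / real k else 0)"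
    unfolding c(2) by (rule height_combination[OF F]) simp
  then show "\<exists>m::nat. height v x = real m / real k"
    by (auto intro: exI[of _ 0])
qed

text \<open>The total height separates lattice points from the origin, the only point not projected
  to the sphere.\<close>

lemma lattice_nonzero:
  assumes "x \<in> icosahedral_configuration P k" "k \<ge> 1"
  shows "x \<noteq> 0"
proof
  assume "x = 0"
  then have "total_height x = 0"
    using height_scale[of 0 _ 0] by (simp add: total_height_def)
  then show False
    using lattice_heights(1)[OF assms] by simp
qed

lemma separation_bound:
  "\<exists>s>0. \<forall>k\<ge>1. \<forall>x\<in>radial_icosahedral_configuration P k.
     \<forall>y\<in>radial_icosahedral_configuration P k. x \<noteq> y \<longrightarrow> s / real k \<le> dist x y"
proof -
  obtain K where K: "K > 0"
    "\<And>v x y. \<lbrakk>v \<in> vertices P; x \<in> sphere 0 1; y \<in> sphere 0 1\<rbrakk> \<Longrightarrow>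
      \<bar>bary v x - bary v y\<bar> \<le> K * norm (x - y)"
    using bary_lipschitz_on_sphere by blast
  have "(1 / K) / real k \<le> dist (radial_projection x) (radial_projection y)"
    if k: "k \<ge> 1" and x: "x \<in> icosahedral_configuration P k"
      and y: "y \<in> icosahedral_configuration P k"
      and "radial_projection x \<noteq> radial_projection y" for k x y
  proof -
    \<comment> \<open>The heights determine the point, so distinct points differ in some
      height.\<close>
    have "(\<Sum>v\<in>vertices P. height v x *\<^sub>R v) \<noteq> (\<Sum>v\<in>vertices P. height v y *\<^sub>R v)"
      using that(4) by (auto simp: sum_height)
    then obtain v where v: "v \<in> vertices P" "height v x \<noteq> height v y"
      by (metis (no_types, lifting) sum.cong)
    obtain m n :: nat where mn: "height v x = real m / real k" "height v y = real n / real k"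
      using lattice_heights(2)[OF x k] lattice_heights(2)[OF y k] by metis
    have "m \<noteq> n"
      using v(2) mn by auto
    then have "1 \<le> \<bar>real m - real n\<bar>"
      by linarith
    then have "1 / real k \<le> \<bar>height v x - height v y\<bar>"
      using k by (simp add: mn abs_divide divide_right_mono flip: diff_divide_distrib)
    moreover have nz: "x \<noteq> 0" "y \<noteq> 0"
      using lattice_nonzero x y k by blast+
    \<comment> \<open>Invariance along rays, together with total height 1, recovers the heights of
      lattice points from their projections.\<close>
    have "bary v (radial_projection z) = bary v z" if "z \<noteq> 0" for z
      using that by (simp add: radial_projection_def bary_scale)
    then have "bary v (radial_projection x) = height v x" "bary v (radial_projection y) = height v y"
      using nz lattice_heights(1) x y k by (auto simp: bary_def)
    moreover have "\<bar>bary v (radial_projection x) - bary v (radial_projection y)\<bar> \<le>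
        K * norm (radial_projection x - radial_projection y)"
      using nz by (intro K(2)[OF v(1)]) (auto simp: radial_projection_def)
    ultimately have "1 / real k \<le> K * dist (radial_projection x) (radial_projection y)"
      by (simp add: dist_norm)
    then have "(1 / real k) / K \<le> dist (radial_projection x) (radial_projection y)"
      using K(1) by (simp only: pos_divide_le_eq mult.commute)
    then show ?thesis
      by (simp add: mult.commute)
  qed
  then show ?thesis
    using K(1) by (intro exI[of _ "1 / K"]) (auto simp: radial_icosahedral_configuration_def)
qed

section \<open>The covering bound\<close>

lemma covering_bound:
  "\<exists>C. \<forall>k\<ge>1. \<forall>y. norm y = 1 \<longrightarrow>
     (\<exists>x\<in>radial_icosahedral_configuration P k. dist x y \<le> C / real k)"
proof -
  obtain r where r: "r > 0" "ball 0 r \<subseteq> interior P"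
    using zero_interior open_interior open_contains_ball by metis
  have "\<exists>x\<in>radial_icosahedral_configuration P k. dist x y \<le> (8 / r) / real k"
    if k: "k \<ge> 1" and y: "norm y = 1" for k y
  proof -
    have "y \<noteq> 0"
      using y by auto
    then obtain F d where F: "F facet_of P" and d: "d > 0" "d *\<^sub>R y \<in> F" "d *\<^sub>R y \<notin> interior P"
      using ray_meets_facet by metis
    \<comment> \<open>The exit point has norm \<open>d\<close> and lies outside the interior, hence
      outside the ball of radius \<open>r\<close>.\<close>
    have "r \<le> d"
      using d r(2) y by (force simp: not_less[symmetric])
    obtain c where c: "\<And>v. v \<in> vertices F \<Longrightarrow> 0 \<le> c v" "sum c (vertices F) = 1"
      "d *\<^sub>R y = (\<Sum>v\<in>vertices F. c v *\<^sub>R v)"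
      using facet_point_coords[OF F d(2)] by blast
    obtain A B C where V: "vertices F = {A, B, C}" and neq: "A \<noteq> B" "A \<noteq> C" "B \<noteq> C"
      using card_vertices_facet[OF F] by (auto simp: card_3_iff)
    have nonneg: "0 \<le> c A" "0 \<le> c B" "0 \<le> c C"
      using c(1) V by auto
    have sum_c: "c A + c B + c C = 1"
      using c(2) V neq by (simp add: add.assoc)
    have norms: "norm A = 1" "norm B = 1" "norm C = 1"
      using norm_vertex V vertices_facet_subset(1)[OF F] by auto
    \<comment> \<open>Round the weights of \<open>B\<close> and \<open>C\<close> down and let
      \<open>A\<close> absorb the rest; \<open>p + q \<le> k\<close> follows because the weight of
      \<open>A\<close> is nonnegative.\<close>
    define p q where "p = nat \<lfloor>k * c B\<rfloor>" and "q = nat \<lfloor>k * c C\<rfloor>"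
    have p: "real p \<le> k * c B" "k * c B \<le> real p + 1" and q: "real q \<le> k * c C" "k * c C \<le> real q + 1"
      using nonneg k by (auto simp: p_def q_def)
    have "real p + real q \<le> k * (c A + c B + c C)"
      using p q mult_nonneg_nonneg[OF of_nat_0_le_iff[of k] nonneg(1)] by (simp add: distrib_left)
    then have "p + q \<le> k"
      by (simp add: sum_c)
    define x where "x = A + real p *\<^sub>R ((B - A) /\<^sub>R real k) + real q *\<^sub>R ((C - A) /\<^sub>R real k)"
    have "x \<in> face_lattice k F"
      unfolding x_def using V \<open>p + q \<le> k\<close> by (rule face_latticeI)
    then have "radial_projection x \<in> radial_icosahedral_configuration P k"
      using F by (auto simp: radial_icosahedral_configuration_def icosahedral_configuration_def)
    moreover have "dist (radial_projection x) y \<le> (8 / r) / real k"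
    proof -
      have "d *\<^sub>R y = c A *\<^sub>R A + c B *\<^sub>R B + c C *\<^sub>R C"
        using c(3) V neq by (simp add: add.assoc)
      also have "c A = 1 - c B - c C"
        using sum_c by simp
      finally have diff: "x - d *\<^sub>R y = (real p / k - c B) *\<^sub>R (B - A) + (real q / k - c C) *\<^sub>R (C - A)"
        by (simp add: x_def algebra_simps divide_inverse)
      have "\<bar>real m / k - t\<bar> \<le> 1 / k" if "real m \<le> k * t" "k * t \<le> real m + 1" for m :: nat and t :: real
      proof -
        have "real m / k \<le> t" "t \<le> (real m + 1) / k"
          using that k by (simp_all add: pos_divide_le_eq pos_le_divide_eq mult.commute)
        then show ?thesis
          by (simp add: add_divide_distrib abs_le_iff)
      qed
      then have coeffs: "\<bar>real p / k - c B\<bar> \<le> 1 / k" "\<bar>real q / k - c C\<bar> \<le> 1 / k"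
        using p q by blast+
      \<comment> \<open>Two rounding errors of at most \<open>1 / k\<close> along edges of length at
        most 2 give \<open>4 / k\<close>; the projection doubles this and divides by
        \<open>d \<ge> r\<close>, which explains the constant \<open>8 / r\<close>.\<close>
      have edges: "norm (B - A) \<le> 2" "norm (C - A) \<le> 2"
        using norm_triangle_ineq4[of B A] norm_triangle_ineq4[of C A] norms by auto
      have "norm (x - d *\<^sub>R y) \<le>
          \<bar>real p / k - c B\<bar> * norm (B - A) + \<bar>real q / k - c C\<bar> * norm (C - A)"
        unfolding diff using norm_triangle_ineq by (metis norm_scaleR)
      also have "\<dots> \<le> 1 / k * 2 + 1 / k * 2"
        by (intro add_mono mult_mono coeffs edges) simp_all
      finally have "norm (x - d *\<^sub>R y) \<le> 1 / k * 2 + 1 / k * 2" .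
      then have "2 * norm (x - d *\<^sub>R y) / d \<le> (8 / k) / d"
        using d(1) by (intro divide_right_mono) auto
      also have "\<dots> \<le> (8 / k) / r"
        using r(1) \<open>r \<le> d\<close> by (intro divide_left_mono) auto
      finally have "2 * norm (x - d *\<^sub>R y) / norm (d *\<^sub>R y) \<le> (8 / r) / k"
        using d(1) y by (simp add: mult.commute)
      moreover have "radial_projection (d *\<^sub>R y) = y"
        using d(1) y by (simp add: radial_projection_def)
      ultimately show ?thesis
        using norm_radial_projection_diff_le[of "d *\<^sub>R y" x] d(1) \<open>y \<noteq> 0\<close>
        by (simp add: dist_norm)
    qed
    ultimately show ?thesis by blast
  qed
  then show ?thesis
    by blast
qed

section \<open>The configurations are finite subsets of the sphere with at least two points\<close>

lemma vertex_in_configuration: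
  assumes F: "F facet_of P" and v: "v \<in> vertices F"
  shows "v \<in> radial_icosahedral_configuration P k"
proof -
  obtain w1 w2 where V: "vertices F = {v, w1, w2}"
  proof -
    have "card (vertices F - {v}) = 2"
      using card_vertices_facet[OF F] v by simp
    then show thesis
      using that v by (metis card_2_iff insert_Diff)
  qed
  have "v \<in> face_lattice k F"
    using face_latticeI[OF V, of 0 0 k] by simp
  then have "v \<in> icosahedral_configuration P k"
    using F unfolding icosahedral_configuration_def by blast
  moreover have "radial_projection v = v"
    using norm_vertex v vertices_facet_subset(1)[OF F] by (auto simp: radial_projection_def)
  ultimately show ?thesis
    unfolding radial_icosahedral_configuration_def by (metis imageI)
qed

lemma finite_face_lattice:
  assumes "F facet_of P"
  shows "finite (face_lattice k F)"
proof (rule finite_subset)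
  let ?V = "vertices F"
  let ?f = "\<lambda>(v, w1, w2, p, q). v + real p *\<^sub>R ((w1 - v) /\<^sub>R real k) + real q *\<^sub>R ((w2 - v) /\<^sub>R real k)"
  show "face_lattice k F \<subseteq> ?f ` (?V \<times> ?V \<times> ?V \<times> {..k} \<times> {..k})"
  proof
    fix x assume "x \<in> face_lattice k F"
    then obtain v w1 w2 p q where "vertices F = {v, w1, w2}" "p + q \<le> k" "x = ?f (v, w1, w2, p, q)"
      unfolding face_lattice_def by auto
    then show "x \<in> ?f ` (?V \<times> ?V \<times> ?V \<times> {..k} \<times> {..k})"
      by (intro image_eqI[of _ ?f "(v, w1, w2, p, q)"]) auto
  qed
  show "finite (?f ` (?V \<times> ?V \<times> ?V \<times> {..k} \<times> {..k}))"
    using finite_vertices_facet[OF assms] by simp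
qed

lemma spherical_configuration_radial:
  assumes k: "k \<ge> 1"
  shows "spherical_configuration (radial_icosahedral_configuration P k)"
proof -
  let ?W = "radial_icosahedral_configuration P k"
  have fin: "finite ?W"
    unfolding radial_icosahedral_configuration_def icosahedral_configuration_def
    using finite_facets finite_face_lattice by auto
  obtain F where F: "F facet_of P"
    using facet_cones_cover by blast
  \<comment> \<open>The projection fixes the vertices, so one facet already supplies three distinct
    points.\<close>
  have "vertices F \<subseteq> ?W"
    using vertex_in_configuration[OF F] by blast
  from card_mono[OF fin this] have "card ?W \<ge> 2"
    using card_vertices_facet[OF F] by simp
  moreover have "?W \<subseteq> sphere 0 1"
    using lattice_nonzero[OF _ k]
    by (auto simp: radial_icosahedral_configuration_def radial_projection_def)
  ultimately show ?thesis
    using fin by (simp add: spherical_configuration_def)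
qed

theorem quasi_uniform_radial: "quasi_uniform (radial_icosahedral_configuration P)"
proof -
  obtain s where "s > 0" "\<And>k x y. \<lbrakk>k \<ge> 1; x \<in> radial_icosahedral_configuration P k;
       y \<in> radial_icosahedral_configuration P k; x \<noteq> y\<rbrakk> \<Longrightarrow> s / real k \<le> dist x y"
    using separation_bound by blast
  moreover obtain C where "\<And>k y. \<lbrakk>k \<ge> 1; norm y = 1\<rbrakk> \<Longrightarrow>
    \<exists>x\<in>radial_icosahedral_configuration P k. dist x y \<le> C / real k"
    using covering_bound by blast
  ultimately show ?thesis
    using quasi_uniformI[of "radial_icosahedral_configuration P" s C] spherical_configuration_radial
    by blast
qed

end

section \<open>The regular icosahedron as an inscribed simplicial polytope\<close>

lemma regular_icosahedron_zero_interior: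
  assumes P: "regular_icosahedron P" and centered: "centered_at_origin P"
  shows "0 \<in> interior P"
proof -
  have poly: "polytope P" and dim: "aff_dim P = 3"
    using P by (auto simp: regular_icosahedron_def)
  have hull: "P = convex hull (vertices P)"
    unfolding vertices_def
    using poly by (intro Krein_Milman_Minkowski polytope_imp_compact polytope_imp_convex)
  have fin: "finite (vertices P)"
    unfolding vertices_def using poly finite_polyhedron_extreme_points polytope_imp_polyhedron by blast
  have "vertices P \<noteq> {}"
    using hull dim by (metis aff_dim_empty_eq convex_hull_empty neg_one_eq_numeral_iff(1)
      numeral_neq_neg_one)
  then have n: "card (vertices P) > 0"
    using fin by (simp add: card_gt_0_iff)
  \<comment> \<open>Equal weights express the centroid with all coefficients positive, which puts it
    in the relative interior of the hull; full dimension makes this the interior.\<close>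
  define u where "u = (\<lambda>_ :: real ^ 3. 1 / real (card (vertices P)))"
  have "sum u (vertices P) = 1" "\<forall>x\<in>vertices P. 0 < u x"
    using n by (auto simp: u_def)
  moreover have "(\<Sum>x\<in>vertices P. u x *\<^sub>R x) = 0"
    using centered by (simp add: u_def centered_at_origin_def flip: scaleR_sum_right)
  ultimately have "0 \<in> rel_interior (convex hull (vertices P))"
    using explicit_subset_rel_interior_convex_hull_minimal[OF fin] by blast
  then have "0 \<in> rel_interior P"
    using hull by simp
  moreover have "affine hull P = UNIV"
    using dim by (intro affine_hull_UNIV) simp
  ultimately show ?thesis
    by (simp add: rel_interior_interior)
qed

text \<open>A dimension count: facets have dimension 2, so the three points spanning one must be
  distinct and affinely independent, and then each of them is an extreme point.\<close>

lemma regular_icosahedron_facet: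
  assumes P: "regular_icosahedron P" and F: "F facet_of P"
  shows "card (vertices F) = 3" "\<not> affine_dependent (vertices F)"
proof -
  obtain A B C where hull: "F = convex hull {A, B, C}"
    using P F unfolding regular_icosahedron_def equilateral_triangle_def by blast
  have "aff_dim P = 3"
    using P by (simp add: regular_icosahedron_def)
  then have dim: "aff_dim {A, B, C} = 2"
    using F hull by (simp add: facet_of_def aff_dim_convex_hull)
  have "card {A, B, C} \<le> 3"
    by (simp add: card_insert_if)
  moreover have "aff_dim {A, B, C} \<le> int (card {A, B, C}) - 1"
    by (rule aff_dim_le_card) simp
  ultimately have card: "card {A, B, C} = 3"
    using dim by linarith
  then have indep: "\<not> affine_dependent {A, B, C}"
    using dim by (simp add: affine_independent_iff_card)
  then have "vertices F = {A, B, C}"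
    unfolding vertices_def hull by (auto simp: extreme_point_of_convex_hull_affine_independent)
  then show "card (vertices F) = 3" "\<not> affine_dependent (vertices F)"
    using card indep by simp_all
qed

theorem proposition5:
  fixes P :: "(real ^ 3) set"
  assumes "regular_icosahedron P"
    and "centered_at_origin P"
    and "has_circumradius P 1"
  shows "quasi_uniform (radial_icosahedral_configuration P)"
proof -
  interpret inscribed_simplicial_polytope P
    using assms regular_icosahedron_facet regular_icosahedron_zero_interior
    by unfold_locales (auto simp: regular_icosahedron_def has_circumradius_def)
  show ?thesis
    by (rule quasi_uniform_radial)
qed

end
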